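(* Let $G=(V,q)$ be a finite connected reversible graph with non-negative Ollivier curvature and invariant measure $m$. Let $\lambda_1$ be the smallest non-zero eigenvalue of $-\Delta$. Then \[ \lambda_1\le\frac{16\log 2}{q_{\min}}\,h^2. \]
   Context: A graph $G=(V,q)$: $V$ finite, $q:V\times V\to[0,\infty)$; Laplacian $\Delta f(x)=\sum_yq(x,y)(f(y)-f(x))$. Reversible with invariant measure $m:V\to(0,\infty)$: $q(x,y)m(x)=q(y,x)m(y)$ (so $-\Delta$ is self-adjoint on $\ell_2(V,m)$). $d$ is the combinatorial graph distance ($x\sim y$ iff $q(x,y)>0$). $q_{\min}=\min\{q(x,y):q(x,y)>0\}$. $|\partial A|=\sum_{x\in A}\sum_{y\in V\setminus A}m(x)q(x,y)$, $m(A)=\sum_{x\in A}m(x)$, and the Cheeger constant is $h=\inf\{|\partial A|/m(A):\ \emptyset\ne A\subset V,\ 2m(A)\le m(V)\}$. Ollivier curvature: for $x\ne y$, $\nabla_{xy}f=(f(x)-f(y))/d(x,y)$, $\|\nabla f\|_\infty=\sup_{x\ne y}|\nabla_{xy}f|$, $\kappa(x,y)=\inf\{\nabla_{xy}\Delta f:\|\nabla f\|_\infty=1,\ \nabla_{yx}f=1\}$; non-negative means $\kappa(x,y)\ge0$ for all $x\ne y$. *)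

theory Defs
  imports Complex_Main
begin

text \<open>Vertex set V = UNIV of a finite type 'a; transition rates q :: 'a => 'a => real.\<close>

definition laplacian :: "('a::finite \<Rightarrow> 'a \<Rightarrow> real) \<Rightarrow> ('a \<Rightarrow> real) \<Rightarrow> 'a \<Rightarrow> real" where
  "laplacian q f x = (\<Sum>y\<in>UNIV. q x y * (f y - f x))"

definition reversible :: "('a::finite \<Rightarrow> 'a \<Rightarrow> real) \<Rightarrow> ('a \<Rightarrow> real) \<Rightarrow> bool" where
  "reversible q m \<longleftrightarrow> (\<forall>x. m x > 0) \<and> (\<forall>x y. q x y * m x = q y x * m y)"

definition adj :: "('a \<Rightarrow> 'a \<Rightarrow> real) \<Rightarrow> ('a \<times> 'a) set" where
  "adj q = {(x, y). q x y > 0}"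

definition connected_graph :: "('a \<Rightarrow> 'a \<Rightarrow> real) \<Rightarrow> bool" where
  "connected_graph q \<longleftrightarrow> (\<forall>x y. (x, y) \<in> (adj q)\<^sup>*)"

text \<open>Combinatorial graph distance: length of a shortest path.\<close>
definition gdist :: "('a \<Rightarrow> 'a \<Rightarrow> real) \<Rightarrow> 'a \<Rightarrow> 'a \<Rightarrow> nat" where
  "gdist q x y = (LEAST n. (x, y) \<in> (adj q) ^^ n)"

definition grad :: "('a \<Rightarrow> 'a \<Rightarrow> real) \<Rightarrow> 'a \<Rightarrow> 'a \<Rightarrow> ('a \<Rightarrow> real) \<Rightarrow> real" where
  "grad q x y f = (f x - f y) / real (gdist q x y)"

definition grad_sup_norm :: "('a \<Rightarrow> 'a \<Rightarrow> real) \<Rightarrow> ('a \<Rightarrow> real) \<Rightarrow> real" where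
  "grad_sup_norm q f = (SUP p\<in>{(x, y). x \<noteq> y}. \<bar>grad q (fst p) (snd p) f\<bar>)"

definition ollivier_curvature :: "('a::finite \<Rightarrow> 'a \<Rightarrow> real) \<Rightarrow> 'a \<Rightarrow> 'a \<Rightarrow> real" where
  "ollivier_curvature q x y =
     Inf {grad q x y (laplacian q f) | f. grad_sup_norm q f = 1 \<and> grad q y x f = 1}"

definition nonneg_ollivier :: "('a::finite \<Rightarrow> 'a \<Rightarrow> real) \<Rightarrow> bool" where
  "nonneg_ollivier q \<longleftrightarrow> (\<forall>x y. x \<noteq> y \<longrightarrow> ollivier_curvature q x y \<ge> 0)"

definition q_min :: "('a::finite \<Rightarrow> 'a \<Rightarrow> real) \<Rightarrow> real" where
  "q_min q = Min {q x y | x y. q x y > 0}"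

definition meas :: "('a \<Rightarrow> real) \<Rightarrow> 'a set \<Rightarrow> real" where
  "meas m A = (\<Sum>x\<in>A. m x)"

definition boundary :: "('a::finite \<Rightarrow> 'a \<Rightarrow> real) \<Rightarrow> ('a \<Rightarrow> real) \<Rightarrow> 'a set \<Rightarrow> real" where
  "boundary q m A = (\<Sum>x\<in>A. \<Sum>y\<in>UNIV - A. m x * q x y)"

definition cheeger :: "('a::finite \<Rightarrow> 'a \<Rightarrow> real) \<Rightarrow> ('a \<Rightarrow> real) \<Rightarrow> real" where
  "cheeger q m = Inf {boundary q m A / meas m A | A. A \<noteq> {} \<and> 2 * meas m A \<le> meas m UNIV}"

text \<open>lam is an eigenvalue of the operator -Delta.\<close>
definition is_eigenvalue_negLap :: "('a::finite \<Rightarrow> 'a \<Rightarrow> real) \<Rightarrow> real \<Rightarrow> bool" where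
  "is_eigenvalue_negLap q lam \<longleftrightarrow> (\<exists>f. f \<noteq> (\<lambda>_. 0) \<and> (\<forall>x. - laplacian q f x = lam * f x))"

definition smallest_nonzero_eigenvalue :: "('a::finite \<Rightarrow> 'a \<Rightarrow> real) \<Rightarrow> real \<Rightarrow> bool" where
  "smallest_nonzero_eigenvalue q lam \<longleftrightarrow>
     is_eigenvalue_negLap q lam \<and> lam \<noteq> 0 \<and>
     (\<forall>mu. is_eigenvalue_negLap q mu \<and> mu \<noteq> 0 \<longrightarrow> lam \<le> mu)"

end

theory Submission
  imports "HOL-Analysis.Cartesian_Euclidean_Space" Defs
begin

text \<open>
  Let \<open>v\<close> solve the resolvent equation \<open>v - \<tau> L v = 1\<^sub>A\<close> with \<open>\<tau> = 1 / lam\<close>. Summation by parts over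
  \<open>A\<close> bounds \<open>\<langle>1\<^sub>A, 1\<^sub>A - v\<rangle>\<close> by \<open>\<tau> \<bar>\<partial>A\<bar> Lip(v)\<close>, while the spectral gap bounds it from below by
  \<open>m(A) / 4\<close>. The Lipschitz constant is estimated by an elliptic maximum principle:
  non-negative curvature lets one compare \<open>v b - v a\<close> with the solution
  \<open>\<phi>(r) = 1 - (1 - p) ^ r\<close> of the one-dimensional equation \<open>\<phi> - 2 q_min \<tau> \<phi>'' = 1\<close>,
  \<open>\<phi>(0) = 0\<close>, on the natural numbers (with \<open>\<phi>''\<close> the second difference), which gives
  \<open>Lip(v) \<le> p \<le> 1 / sqrt (2 q_min \<tau>)\<close>. This yields \<open>lam \<le> 8 h\<^sup>2 / q_min\<close>, and
  \<open>8 \<le> 16 ln 2\<close>.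
\<close>

section \<open>Concave sequences, relation powers and linearity of the Laplacian\<close>

text \<open>The forward increment at \<open>d\<close> is a supergradient: later increments are at
  most this one, earlier ones at least, so telescoping works on both sides of
  \<open>d\<close>.\<close>

lemma concave_seq_le_tangent:
  fixes \<phi> :: "nat \<Rightarrow> real"
  assumes conc: "\<And>r. \<phi> (r + 2) - \<phi> (r + 1) \<le> \<phi> (r + 1) - \<phi> r"
  shows "\<phi> k - \<phi> d \<le> (\<phi> (d + 1) - \<phi> d) * (real k - real d)"
proof -
  have anti: "\<phi> (Suc j) - \<phi> j \<le> \<phi> (Suc i) - \<phi> i" if "i \<le> j" for i j
    using that
  proof (induction rule: dec_induct)
    case (step n)
    then show ?case using conc[of n] by (simp add: numeral_2_eq_2)
  qed simp
  show ?thesis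
  proof (cases "d \<le> k")
    case True
    then show ?thesis
    proof (induction rule: dec_induct)
      case (step n)
      have "\<phi> (Suc n) - \<phi> n \<le> \<phi> (d + 1) - \<phi> d"
        using anti[of d n] step by simp
      with step show ?case by (simp add: algebra_simps)
    qed simp
  next
    case False
    then have "k \<le> d" by simp
    then show ?thesis
    proof (induction rule: inc_induct)
      case (step n)
      have "\<phi> (d + 1) - \<phi> d \<le> \<phi> (Suc n) - \<phi> n"
        using anti[of n d] step by simp
      with step show ?case by (simp add: algebra_simps)
    qed simp
  qed
qed

lemma relpow_symI:
  assumes "sym R" "(x, y) \<in> R ^^ n"
  shows "(y, x) \<in> R ^^ n"
  using assms(2)
proof (induction n arbitrary: y)
  case (Suc n)
  then obtain z where "(x, z) \<in> R ^^ n" "(z, y) \<in> R" by auto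
  then show ?case using Suc.IH symD[OF assms(1)] by (blast intro: relpow_Suc_I2)
qed simp

lemma laplacian_add: "laplacian q (\<lambda>z. f z + g z) = (\<lambda>x. laplacian q f x + laplacian q g x)"
  by (simp add: fun_eq_iff laplacian_def algebra_simps sum.distrib sum_subtractf)

lemma laplacian_scale: "laplacian q (\<lambda>z. c * f z) = (\<lambda>x. c * laplacian q f x)"
  by (simp add: fun_eq_iff laplacian_def algebra_simps sum_distrib_left sum_subtractf)

lemma laplacian_const: "laplacian q (\<lambda>z. c) = (\<lambda>_. 0)"
  by (simp add: fun_eq_iff laplacian_def)

locale reversible_graph =
  fixes q :: "'a::finite \<Rightarrow> 'a \<Rightarrow> real" and m :: "'a \<Rightarrow> real"
  assumes q_nonneg: "q x y \<ge> 0"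
    and rev: "reversible q m"
    and conn: "connected_graph q"
begin

abbreviation "d \<equiv> gdist q"
abbreviation "L \<equiv> laplacian q"

definition ip :: "('a \<Rightarrow> real) \<Rightarrow> ('a \<Rightarrow> real) \<Rightarrow> real" where
  "ip f g = (\<Sum>x\<in>UNIV. m x * f x * g x)"

lemma m_pos: "m x > 0" and detailed_balance: "m x * q x y = m y * q y x"
  using rev by (auto simp: reversible_def mult.commute)

lemma adj_sym: "sym (adj q)"
proof (rule symI)
  fix x y assume "(x, y) \<in> adj q"
  then have "0 < m y * q y x"
    using m_pos[of x] by (simp add: adj_def flip: detailed_balance)
  then show "(y, x) \<in> adj q"
    using m_pos[of y] by (simp add: adj_def zero_less_mult_iff)
qed

subsection \<open>Graph distance\<close>

lemma gdist_path: "(x, y) \<in> adj q ^^ d x y"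
proof -
  have "\<exists>n. (x, y) \<in> adj q ^^ n"
    using conn by (auto simp: connected_graph_def rtrancl_power)
  then show ?thesis
    unfolding gdist_def by (rule LeastI_ex)
qed

lemma gdist_le: "(x, y) \<in> adj q ^^ n \<Longrightarrow> d x y \<le> n"
  unfolding gdist_def by (rule Least_le)

lemma gdist_self [simp]: "d x x = 0"
  using gdist_le[of x x 0] by simp

lemma gdist_eq_0 [simp]: "d x y = 0 \<longleftrightarrow> x = y"
  using gdist_path[of x y] by auto

lemma gdist_triangle: "d x z \<le> d x y + d y z"
proof (rule gdist_le)
  show "(x, z) \<in> adj q ^^ (d x y + d y z)"
    using gdist_path[of x y] gdist_path[of y z] by (auto simp: relpow_add)
qed

lemma gdist_sym: "d x y = d y x"
proof -
  have "d b a \<le> d a b" for a b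
    by (rule gdist_le[OF relpow_symI[OF adj_sym gdist_path]])
  then show ?thesis by (simp add: order_antisym)
qed

lemma gdist_edge: "q x y > 0 \<Longrightarrow> d x y \<le> 1"
  by (rule gdist_le) (simp add: adj_def)

lemma gdist_step:
  assumes "x \<noteq> y"
  obtains x' where "q x x' > 0" "Suc (d x' y) = d x y"
proof -
  obtain n where n: "d x y = Suc n" using assms by (metis gdist_eq_0 not0_implies_Suc)
  then have "(x, y) \<in> adj q ^^ Suc n" using gdist_path by metis
  then obtain x' where x': "(x, x') \<in> adj q" "(x', y) \<in> adj q ^^ n"
    by (metis relpow_Suc_D2)
  then have "q x x' > 0" by (simp add: adj_def)
  moreover have "Suc (d x' y) = d x y"
    using gdist_le[OF x'(2)] gdist_triangle[of x y x'] gdist_edge[OF \<open>q x x' > 0\<close>] n by simp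
  ultimately show ?thesis using that by blast
qed

lemma finite_rates: "finite {q x y | x y. q x y > 0}"
proof (rule finite_subset)
  show "{q x y | x y. q x y > 0} \<subseteq> (\<lambda>(x, y). q x y) ` UNIV" by auto
qed simp

lemma q_min_le: "q x y > 0 \<Longrightarrow> q_min q \<le> q x y"
  unfolding q_min_def by (rule Min_le[OF finite_rates]) auto

text \<open>\<open>Min\<close> of an empty set is unspecified; two distinct vertices and
  connectedness guarantee a positive rate.\<close>

lemma q_min_pos:
  assumes "x \<noteq> (y::'a)"
  shows "q_min q > 0"
proof -
  obtain x' where "q x x' > 0" using gdist_step[OF assms] by blast
  then have "q_min q \<in> {q x y | x y. q x y > 0}"
    unfolding q_min_def by (intro Min_in finite_rates) auto
  then show ?thesis by auto
qed

subsection \<open>Curvature\<close>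

text \<open>The curvature hypothesis in usable form: for \<open>s > 0\<close>, dividing
  \<open>f\<close> by \<open>s\<close> gives a competitor in the infimum defining the
  curvature.\<close>

lemma laplacian_le_of_contact_linear:
  fixes f :: "'a \<Rightarrow> real" and s :: real
  assumes curv: "nonneg_ollivier q" and "x \<noteq> y" and "0 \<le> s"
    and lip: "\<And>a b. f b - f a \<le> s * d a b" and eq: "f y - f x = s * d x y"
  shows "L f y \<le> L f x"
proof (cases "s = 0")
  case True
  then have "f = (\<lambda>_. f x)"
    using lip by (auto simp: fun_eq_iff order_antisym)
  then show ?thesis by (metis laplacian_const order_refl)
next
  case False
  with \<open>0 \<le> s\<close> have s: "s > 0" by simp
  let ?P = "{(a, b). a \<noteq> (b::'a)}"
  let ?F = "{grad q x y (L g) | g. grad_sup_norm q g = 1 \<and> grad q y x g = 1}"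
  define g where "g = (\<lambda>z. inverse s * f z)"
  have dpos: "real (d a b) > 0" if "a \<noteq> b" for a b
    using that gdist_eq_0[of a b] by linarith
  have glip: "\<bar>grad q a b g\<bar> \<le> 1" if "a \<noteq> b" for a b
    using lip[of a b] lip[of b a] s dpos[OF that] gdist_sym[of a b]
    by (auto simp: grad_def g_def abs_if field_simps)
  have geq: "grad q y x g = 1"
    using eq s dpos[OF \<open>x \<noteq> y\<close>] by (auto simp: grad_def g_def gdist_sym[of y x] field_simps)
  have "grad_sup_norm q g \<le> 1"
    unfolding grad_sup_norm_def using glip \<open>x \<noteq> y\<close> by (intro cSUP_least) auto
  moreover have "\<bar>grad q (fst (y, x)) (snd (y, x)) g\<bar> \<le> grad_sup_norm q g"
    unfolding grad_sup_norm_def using \<open>x \<noteq> y\<close> by (intro cSUP_upper bdd_above_finite) auto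
  ultimately have "grad_sup_norm q g = 1" using geq by simp
  then have mem: "grad q x y (L g) \<in> ?F" using geq by blast
  \<comment> \<open>A real \<open>Inf\<close> is known to lie below its members only when the set is
    bounded below; here the Laplacian of a 1-Lipschitz function is uniformly bounded.\<close>
  have bdd: "bdd_below ?F"
  proof (rule bdd_belowI)
    fix c assume "c \<in> ?F"
    then obtain g where g: "grad_sup_norm q g = 1" and c: "c = grad q x y (L g)" by blast
    have lip: "\<bar>g b - g a\<bar> \<le> d a b" for a b
    proof (cases "a = b")
      case False
      have "\<bar>grad q (fst (a, b)) (snd (a, b)) g\<bar> \<le> grad_sup_norm q g"
        unfolding grad_sup_norm_def using False by (intro cSUP_upper bdd_above_finite) auto
      then show ?thesis using g dpos[OF False] by (simp add: grad_def field_simps abs_minus_commute)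
    qed simp
    have bound: "\<bar>L g z\<bar> \<le> (\<Sum>w\<in>UNIV. q z w * d z w)" for z
      unfolding laplacian_def
      by (rule order_trans[OF sum_abs]) (intro sum_mono, simp add: abs_mult q_nonneg lip mult_left_mono)
    show "(- (\<Sum>w\<in>UNIV. q x w * d x w) - (\<Sum>w\<in>UNIV. q y w * d y w)) / d x y \<le> c"
      unfolding c grad_def using bound[of x] bound[of y] by (intro divide_right_mono) auto
  qed
  have "0 \<le> ollivier_curvature q x y"
    using curv \<open>x \<noteq> y\<close> by (simp add: nonneg_ollivier_def)
  also have "\<dots> \<le> grad q x y (L g)"
    unfolding ollivier_curvature_def using mem bdd by (rule cInf_lower)
  finally have "L g y \<le> L g x"
    using dpos[OF \<open>x \<noteq> y\<close>] by (auto simp: grad_def zero_le_divide_iff)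
  then show ?thesis
    using s by (simp add: g_def laplacian_scale)
qed

text \<open>
  A contact point of a concave modulus of continuity. Truncating the increments of \<open>u\<close> around
  \<open>x\<close> from above by the slope \<open>s\<close> of \<open>\<phi>\<close> to the right of \<open>d x y\<close>, and those around \<open>y\<close> from
  below by \<open>-s\<close>, gives an \<open>s\<close>-Lipschitz function to which the curvature bound applies; on the
  geodesic steps from \<open>x\<close> to \<open>y\<close> and from \<open>y\<close> to \<open>x\<close> the truncation gains the second difference
  of \<open>\<phi>\<close>.
\<close>
lemma laplacian_le_of_contact_concave:
  fixes \<phi> :: "nat \<Rightarrow> real" and u :: "'a \<Rightarrow> real"
  assumes curv: "nonneg_ollivier q" and "x \<noteq> y"
    and mono: "\<And>r. \<phi> r \<le> \<phi> (r + 1)"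
    and conc: "\<And>r. \<phi> (r + 2) - \<phi> (r + 1) \<le> \<phi> (r + 1) - \<phi> r"
    and mod: "\<And>a b. u b - u a \<le> \<phi> (d a b)" and eq: "u y - u x = \<phi> (d x y)"
  shows "L u y - L u x \<le> 2 * q_min q * (\<phi> (d x y + 1) - 2 * \<phi> (d x y) + \<phi> (d x y - 1))"
proof -
  define D where "D = d x y"
  define s where "s = \<phi> (D + 1) - \<phi> D"
  define \<delta> where "\<delta> = \<phi> (D + 1) - 2 * \<phi> D + \<phi> (D - 1)"
  define A where "A = (\<lambda>z. min (u z - u x) s)"
  define B where "B = (\<lambda>z. max (u z - u y) (- s))"
  have s: "0 \<le> s" using mono by (simp add: s_def)
  have D: "D > 0" using \<open>x \<noteq> y\<close> unfolding D_def using gdist_eq_0 by blast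
  have \<delta>: "\<delta> \<le> 0" using conc[of "D - 1"] D by (simp add: \<delta>_def numeral_2_eq_2)
  have tangent: "\<phi> k - \<phi> D \<le> s * (real k - real D)" for k
    unfolding s_def using concave_seq_le_tangent[of \<phi>, OF conc] .
  \<comment> \<open>Four cases, by which of \<open>A x'\<close> and \<open>B y'\<close> are
    truncated. The modulus is used at \<open>d x' y'\<close> (none), \<open>d x y'\<close> (only
    \<open>A\<close>) or \<open>d x' y\<close> (only \<open>B\<close>); if both are,
    \<open>D \<le> d x' y' + 2\<close> suffices.\<close>
  have key: "B y' - A x' \<le> s * (real (d x' y') - D)"
    if x': "d x x' \<le> 1" and y': "d y y' \<le> 1" for x' y'
  proof -
    have t1: "real (d x y') \<le> d x' y' + 1"
      using gdist_triangle[of x y' x'] x' by linarith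
    have t2: "real (d x' y) \<le> d x' y' + 1"
      using gdist_triangle[of x' y y'] y' gdist_sym[of y y'] by linarith
    have t3: "real D \<le> d x' y + 1"
      unfolding D_def using gdist_triangle[of x y x'] x' by linarith
    have 1: "(u y' - u y) - (u x' - u x) \<le> s * (real (d x' y') - D)"
      using mod[of y' x'] tangent[of "d x' y'"] eq by (simp add: D_def)
    have "(u y' - u y) \<le> s * (real (d x y') - D)"
      using mod[of y' x] tangent[of "d x y'"] eq by (simp add: D_def)
    also have "\<dots> \<le> s * ((real (d x' y') + 1) - D)"
      using t1 s by (intro mult_left_mono) auto
    finally have 2: "(u y' - u y) - s \<le> s * (real (d x' y') - D)"
      by (simp add: algebra_simps)
    have "- (u x' - u x) \<le> s * (real (d x' y) - D)"
      using mod[of y x'] tangent[of "d x' y"] eq by (simp add: D_def)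
    also have "\<dots> \<le> s * ((real (d x' y') + 1) - D)"
      using t2 s by (intro mult_left_mono) auto
    finally have 3: "- s - (u x' - u x) \<le> s * (real (d x' y') - D)"
      by (simp add: algebra_simps)
    have "s * (- 2) \<le> s * (real (d x' y') - D)"
      using t2 t3 s by (intro mult_left_mono) auto
    then have 4: "- s - s \<le> s * (real (d x' y') - D)" by simp
    show ?thesis
      using 1 2 3 4 unfolding A_def B_def by (auto simp: min_def max_def)
  qed
  \<comment> \<open>McShane extension: \<open>f\<close> is the largest \<open>s\<close>-Lipschitz
    function below \<open>A\<close> on the unit ball around \<open>x\<close>. By \<open>key\<close>
    it stays above \<open>s * D + B\<close> on the unit ball around \<open>y\<close>.\<close>
  define N where "N = {x'. d x x' \<le> 1}"
  define f where "f = (\<lambda>z. Min ((\<lambda>x'. A x' + s * d x' z) ` N))"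
  have "x \<in> N" by (simp add: N_def)
  have f_le: "f z \<le> A x' + s * d x' z" if "x' \<in> N" for x' z
    unfolding f_def using that by (intro Min_le) auto
  have f_ge: "c \<le> f z" if "\<And>x'. x' \<in> N \<Longrightarrow> c \<le> A x' + s * d x' z" for c z
    unfolding f_def using that \<open>x \<in> N\<close> by (subst Min_ge_iff) auto
  have lip: "f b - f a \<le> s * d a b" for a b
  proof -
    have "f b - s * d a b \<le> f a"
    proof (rule f_ge)
      fix x' assume "x' \<in> N"
      have "s * d x' b \<le> s * (real (d x' a) + d a b)"
        using gdist_triangle[of x' b a] s by (intro mult_left_mono) linarith+
      then show "f b - s * d a b \<le> A x' + s * d x' a"
        using f_le[OF \<open>x' \<in> N\<close>, of b] by (simp add: algebra_simps)
    qed
    then show ?thesis by simp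
  qed
  have fA: "f x' \<le> A x'" if "d x x' \<le> 1" for x'
    using f_le[of x' x'] that by (simp add: N_def)
  have fB: "s * D + B y' \<le> f y'" if "d y y' \<le> 1" for y'
    by (rule f_ge) (use key that in \<open>force simp: N_def algebra_simps\<close>)
  \<comment> \<open>The Lipschitz bound between \<open>x\<close> and \<open>y\<close> turns these
    two inequalities into equalities, so \<open>f\<close> is in linear contact there.\<close>
  have "f x \<le> 0" using fA[of x] s by (simp add: A_def)
  moreover have "s * D \<le> f y" using fB[of y] s by (simp add: B_def)
  ultimately have fx: "f x = 0" and fy: "f y = s * D"
    using lip[of y x] unfolding D_def by linarith+
  have "L f y \<le> L f x"
    by (rule laplacian_le_of_contact_linear[OF curv \<open>x \<noteq> y\<close> s lip]) (simp add: fx fy D_def)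
  have gain_x: "L f x \<le> L u x + q_min q * \<delta>"
  proof -
    obtain x' where x': "q x x' > 0" "Suc (d x' y) = D"
      using gdist_step[OF \<open>x \<noteq> y\<close>] unfolding D_def by blast
    \<comment> \<open>\<open>s - \<delta>\<close> is the increment of \<open>\<phi>\<close> from
      \<open>D - 1\<close> to \<open>D\<close>, so truncation at \<open>s\<close> lowers the value
      at \<open>x'\<close> by at least \<open>- \<delta>\<close>.\<close>
    have "u x' - u x \<ge> s - \<delta>"
      using mod[of y x'] eq x'(2) by (auto simp: s_def \<delta>_def D_def[symmetric])
    then have A: "A x' \<le> u x' - u x + \<delta>" by (simp add: A_def min_def)
    have "q x z * (f z - f x) \<le> q x z * (u z - u x) + (if z = x' then q_min q * \<delta> else 0)" for z
    proof (cases "q x z > 0")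
      case True
      have "f z \<le> u z - u x" using fA[OF gdist_edge[OF True]] by (simp add: A_def)
      moreover have "f x' \<le> u x' - u x + \<delta>" using fA[OF gdist_edge[OF x'(1)]] A by simp
      ultimately have "q x z * (f z - f x) \<le> q x z * (u z - u x + (if z = x' then \<delta> else 0))"
        using True fx by (intro mult_left_mono) auto
      moreover have "q x x' * \<delta> \<le> q_min q * \<delta>"
        using q_min_le[OF x'(1)] \<delta> by (rule mult_right_mono_neg)
      ultimately show ?thesis by (auto simp: algebra_simps)
    next
      case False
      then have "q x z = 0" using q_nonneg[of x z] by simp
      then show ?thesis using x' by auto
    qed
    then have "L f x \<le> (\<Sum>z\<in>UNIV. q x z * (u z - u x) + (if z = x' then q_min q * \<delta> else 0))"
      unfolding laplacian_def by (rule sum_mono)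
    then show ?thesis by (simp add: sum.distrib laplacian_def)
  qed
  have gain_y: "L u y - q_min q * \<delta> \<le> L f y"
  proof -
    obtain y' where y': "q y y' > 0" "Suc (d y' x) = D"
      using gdist_step[of y x] \<open>x \<noteq> y\<close> unfolding D_def gdist_sym[of x y] by metis
    have "u y' - u y \<le> \<delta> - s"
      using mod[of y' x] eq y'(2) gdist_sym[of x y'] by (auto simp: s_def \<delta>_def D_def[symmetric])
    then have B: "B y' \<ge> u y' - u y - \<delta>" by (simp add: B_def max_def)
    have "q y z * (u z - u y) - (if z = y' then q_min q * \<delta> else 0) \<le> q y z * (f z - f y)" for z
    proof (cases "q y z > 0")
      case True
      have "f z - f y \<ge> u z - u y" using fB[OF gdist_edge[OF True]] fy by (simp add: B_def)
      moreover have "f y' - f y \<ge> u y' - u y - \<delta>" using fB[OF gdist_edge[OF y'(1)]] B fy by simp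
      ultimately have "q y z * (u z - u y - (if z = y' then \<delta> else 0)) \<le> q y z * (f z - f y)"
        using True by (intro mult_left_mono) auto
      moreover have "q y y' * \<delta> \<le> q_min q * \<delta>"
        using q_min_le[OF y'(1)] \<delta> by (rule mult_right_mono_neg)
      ultimately show ?thesis by (auto simp: algebra_simps)
    next
      case False
      then have "q y z = 0" using q_nonneg[of y z] by simp
      then show ?thesis using y' by auto
    qed
    then have "(\<Sum>z\<in>UNIV. q y z * (u z - u y) - (if z = y' then q_min q * \<delta> else 0)) \<le> L f y"
      unfolding laplacian_def by (rule sum_mono)
    then show ?thesis by (simp add: sum_subtractf laplacian_def)
  qed
  show ?thesis
    using \<open>L f y \<le> L f x\<close> gain_x gain_y by (simp add: \<delta>_def D_def)
qed

section \<open>Two-point maximum principle for the resolvent\<close>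

text \<open>Maximise \<open>v b - v a - \<phi> (d a b)\<close> over all pairs. On the diagonal the
  value is 0; off it, the contact lemma and the resolvent equation force the maximum to be
  nonpositive. The condition on \<open>p\<close> is the one-dimensional equation for
  \<open>\<phi>\<close> at positive integers.\<close>

lemma resolvent_modulus:
  fixes v :: "'a \<Rightarrow> real" and \<tau> p :: real
  assumes curv: "nonneg_ollivier q" and "0 < \<tau>" and "0 < p" "p < 1"
    and p: "2 * q_min q * \<tau> * p\<^sup>2 + p = 1"
    and v: "\<And>z. v z - \<tau> * L v z = g z" and osc: "\<And>a b. g b - g a \<le> 1"
  shows "v b - v a \<le> 1 - (1 - p) ^ d a b"
proof -
  have p': "2 * q_min q * \<tau> * p\<^sup>2 = 1 - p" using p by simp
  define \<phi> where "\<phi> = (\<lambda>r. 1 - (1 - p) ^ r)"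
  define e where "e = (\<lambda>(a, b). v b - v a - \<phi> (d a b))"
  define M where "M = Max (range e)"
  have M: "v b - v a \<le> M + \<phi> (d a b)" for a b
    using Max_ge[of "range e" "e (a, b)"] rangeI[of e "(a, b)"]
    unfolding M_def[symmetric] by (simp add: e_def)
  have "M \<in> range e" unfolding M_def by (intro Max_in) auto
  then obtain x y where "M = e (x, y)" by auto
  then have xy: "v y - v x = M + \<phi> (d x y)" by (simp add: e_def)
  have "M \<le> 0"
  proof (cases "x = y")
    case True
    then show ?thesis using xy by (simp add: \<phi>_def)
  next
    case False
    then obtain n where n: "d x y = Suc n" by (metis gdist_eq_0 not0_implies_Suc)
    \<comment> \<open>Adding the constant \<open>M\<close> makes the maximum an exact contact and
      cancels in the second difference.\<close>
    have "L v y - L v x \<le> 2 * q_min q *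
      ((M + \<phi> (d x y + 1)) - 2 * (M + \<phi> (d x y)) + (M + \<phi> (d x y - 1)))"
    proof (rule laplacian_le_of_contact_concave[OF curv False _ _ M xy])
      fix r :: nat
      have pw: "0 \<le> (1 - p) ^ r" using \<open>p < 1\<close> by simp
      have "\<phi> (r + 1) - \<phi> r = p * (1 - p) ^ r" by (simp add: \<phi>_def algebra_simps)
      then show "M + \<phi> r \<le> M + \<phi> (r + 1)" using pw \<open>0 < p\<close> by (smt (verit) mult_nonneg_nonneg)
      have "(\<phi> (r + 1) - \<phi> r) - (\<phi> (r + 2) - \<phi> (r + 1)) = p\<^sup>2 * (1 - p) ^ r"
        by (simp add: \<phi>_def algebra_simps power2_eq_square)
      moreover have "0 \<le> p\<^sup>2 * (1 - p) ^ r" using pw by simp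
      ultimately show "M + \<phi> (r + 2) - (M + \<phi> (r + 1)) \<le> M + \<phi> (r + 1) - (M + \<phi> r)" by linarith
    qed
    also have "\<dots> = - (2 * q_min q * p\<^sup>2 * (1 - p) ^ n)"
      by (simp add: n \<phi>_def algebra_simps power2_eq_square)
    finally have "\<tau> * (L v y - L v x) \<le> \<tau> * - (2 * q_min q * p\<^sup>2 * (1 - p) ^ n)"
      using \<open>0 < \<tau>\<close> by (intro mult_left_mono) auto
    also have "\<dots> = - (2 * q_min q * \<tau> * p\<^sup>2) * (1 - p) ^ n" by (simp add: algebra_simps)
    also have "\<dots> = - ((1 - p) ^ d x y)" unfolding p' n by (simp add: algebra_simps)
    finally have "\<tau> * (L v y - L v x) \<le> - ((1 - p) ^ d x y)" .
    then have "v y - v x \<le> \<phi> (d x y)"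
      using v[of x] v[of y] osc[of y x] by (simp add: \<phi>_def algebra_simps)
    then show ?thesis using xy by simp
  qed
  then show ?thesis using M[of b a] by (simp add: \<phi>_def)
qed

subsection \<open>Energy and spectrum\<close>

lemma ip_commute: "ip f g = ip g f"
  by (simp add: ip_def mult_ac)

lemma ip_add: "ip (\<lambda>x. f x + g x) h = ip f h + ip g h"
  by (simp add: ip_def algebra_simps sum.distrib)

lemma ip_scale: "ip (\<lambda>x. c * f x) h = c * ip f h"
  by (simp add: ip_def algebra_simps sum_distrib_left)

lemma ip_add_right: "ip h (\<lambda>x. f x + g x) = ip h f + ip h g"
  by (simp add: ip_commute[of h] ip_add)

lemma ip_scale_right: "ip h (\<lambda>x. c * f x) = c * ip h f"
  by (simp add: ip_commute[of h] ip_scale)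

lemma ip_self_nonneg: "0 \<le> ip f f"
  unfolding ip_def using m_pos by (intro sum_nonneg) (simp add: mult.assoc less_imp_le)

lemma ip_self_eq_0: "ip f f = 0 \<longleftrightarrow> f = (\<lambda>_. 0)"
proof -
  have "ip f f = 0 \<longleftrightarrow> (\<forall>x\<in>UNIV. m x * f x * f x = 0)"
    unfolding ip_def using m_pos
    by (intro sum_nonneg_eq_0_iff) (simp_all add: mult.assoc less_imp_le)
  also have "\<dots> \<longleftrightarrow> f = (\<lambda>_. 0)"
    using m_pos[THEN less_imp_neq] by (auto simp: fun_eq_iff)
  finally show ?thesis .
qed

text \<open>Exchanging the summation variables and detailed balance symmetrise the double sum; the
  half compensates for counting each edge in both directions.\<close>

lemma green: "ip f (L g) = - (\<Sum>x\<in>UNIV. \<Sum>y\<in>UNIV. m x * q x y * (f y - f x) * (g y - g x)) / 2"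
proof -
  let ?S = "\<Sum>x\<in>UNIV. \<Sum>y\<in>UNIV. m x * q x y * f x * (g y - g x)"
  have 1: "ip f (L g) = ?S"
    by (simp add: ip_def laplacian_def sum_distrib_left mult_ac)
  have "?S = (\<Sum>y\<in>UNIV. \<Sum>x\<in>UNIV. m x * q x y * f x * (g y - g x))"
    by (rule sum.swap)
  also have "\<dots> = (\<Sum>x\<in>UNIV. \<Sum>y\<in>UNIV. m x * q x y * f y * (g x - g y))"
    by (simp add: detailed_balance)
  finally have "(\<Sum>x\<in>UNIV. \<Sum>y\<in>UNIV. m x * q x y * (f y - f x) * (g y - g x)) = - 2 * ?S"
    by (simp add: algebra_simps sum.distrib sum_subtractf)
  with 1 show ?thesis by simp
qed

lemma ip_laplacian_sym: "ip f (L g) = ip (L f) g"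
  unfolding ip_commute[of "L f"] green by (simp add: mult_ac)

lemma ip_const_laplacian: "ip (\<lambda>_. c) (L g) = 0"
  by (simp add: green)

lemma ip_laplacian_nonpos: "ip f (L f) \<le> 0"
  unfolding green using m_pos q_nonneg
  by (simp add: sum_nonneg mult.assoc less_imp_le)

text \<open>Every edge term of the energy is nonnegative and hence zero; connectedness spreads the
  equality along paths.\<close>

lemma ip_laplacian_eq_0:
  assumes "ip f (L f) = 0"
  shows "f x = f y"
proof -
  have "(\<Sum>x\<in>UNIV. \<Sum>y\<in>UNIV. m x * q x y * (f y - f x) * (f y - f x)) = 0"
    using assms by (simp add: green)
  moreover have nonneg: "0 \<le> m x * q x y * (f y - f x) * (f y - f x)" for x y
    using m_pos[of x] q_nonneg[of x y] by (simp add: mult.assoc)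
  ultimately have "(\<Sum>y\<in>UNIV. m x * q x y * (f y - f x) * (f y - f x)) = 0" for x
    by (subst (asm) sum_nonneg_eq_0_iff) (auto intro: sum_nonneg)
  then have "m x * q x y * (f y - f x) * (f y - f x) = 0" for x y
    using nonneg by (subst (asm) sum_nonneg_eq_0_iff) (auto simp del: mult_eq_0_iff)
  then have edge: "f x = f y" if "(x, y) \<in> adj q" for x y
    using that m_pos[of x] by (auto simp: adj_def) (metis less_irrefl)
  have "(x, y) \<in> (adj q)\<^sup>*" using conn by (simp add: connected_graph_def)
  then show ?thesis by (induction rule: rtrancl_induct) (auto dest: edge)
qed

lemma eigenvalue_pos:
  assumes "is_eigenvalue_negLap q lam" "lam \<noteq> 0"
  shows "lam > 0"
proof -
  obtain f where f: "f \<noteq> (\<lambda>_. 0)" "\<And>x. - L f x = lam * f x"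
    using assms by (auto simp: is_eigenvalue_negLap_def)
  then have "L f = (\<lambda>x. (- lam) * f x)" by (auto simp: fun_eq_iff) (metis minus_equation_iff)
  then have "ip f (L f) = - lam * ip f f" by (metis ip_commute ip_scale)
  moreover have "ip f f > 0" using f ip_self_eq_0[of f] ip_self_nonneg[of f] by simp
  ultimately show ?thesis
    using ip_laplacian_nonpos[of f] assms(2) by (auto simp: mult_le_0_iff zero_le_mult_iff)
qed

text \<open>A minimiser \<open>f\<close> of the Rayleigh quotient is an eigenvector: perturb in direction of the
  residual \<open>-L f - \<mu> f\<close>.\<close>
lemma poincare:
  assumes lam: "smallest_nonzero_eigenvalue q lam" and g: "ip (\<lambda>_. 1) g = 0"
  shows "lam * ip g g \<le> - ip g (L g)"
proof (cases "g = (\<lambda>_. 0)")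
  case True
  then show ?thesis by (simp add: ip_def)
next
  case False
  \<comment> \<open>The unit sphere orthogonal to the constants, placed in \<open>real ^ 'a\<close>
    so that closed and bounded gives compact.\<close>
  define K where "K = {w :: real ^ 'a. ip (\<lambda>_. 1) (($) w) = 0 \<and> ip (($) w) (($) w) = 1}"
  have nth_lambda: "($) (\<chi> x. h x) = h" for h :: "'a \<Rightarrow> real" by (simp add: fun_eq_iff)
  have norm_scale: "\<exists>c. c \<noteq> 0 \<and> (\<chi> x. c * h x) \<in> K" if "ip (\<lambda>_. 1) h = 0" "h \<noteq> (\<lambda>_. 0)" for h
  proof -
    have "ip h h > 0" using that ip_self_eq_0[of h] ip_self_nonneg[of h] by simp
    then have "(\<chi> x. (1 / sqrt (ip h h)) * h x) \<in> K"
      using that unfolding K_def mem_Collect_eq nth_lambda ip_scale ip_scale_right by simp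
    then show ?thesis using \<open>ip h h > 0\<close> by (intro exI[of _ "1 / sqrt (ip h h)"]) auto
  qed
  have cont: "continuous_on UNIV (\<lambda>w :: real ^ 'a. ip (\<lambda>_. 1) (($) w))"
    "continuous_on UNIV (\<lambda>w :: real ^ 'a. ip (($) w) (($) w))"
    "continuous_on UNIV (\<lambda>w :: real ^ 'a. - ip (($) w) (L (($) w)))"
    unfolding ip_def laplacian_def by (intro continuous_intros)+
  have "closed K"
    unfolding K_def by (intro closed_Collect_conj closed_Collect_eq cont continuous_on_const)
  moreover have "bounded K"
  proof (rule boundedI)
    fix w assume "w \<in> K"
    have "\<bar>w $ x\<bar> \<le> 1 + 1 / m x" for x
    proof -
      have "m x * w $ x * w $ x \<le> ip (($) w) (($) w)"
        unfolding ip_def using m_pos by (intro member_le_sum) (auto simp: mult.assoc less_imp_le)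
      then have "(w $ x)\<^sup>2 \<le> 1 / m x"
        using \<open>w \<in> K\<close> m_pos[of x] by (simp add: K_def field_simps power2_eq_square)
      moreover have "\<bar>w $ x\<bar> \<le> 1 + (w $ x)\<^sup>2"
        using zero_le_power2[of "\<bar>w $ x\<bar> - 1 / 2"] by (simp add: power2_diff power_divide)
      ultimately show ?thesis by simp
    qed
    then show "norm w \<le> (\<Sum>x\<in>UNIV. 1 + 1 / m x)"
      by (intro order_trans[OF norm_le_l1_cart] sum_mono)
  qed
  ultimately have "compact K" by (simp add: compact_eq_bounded_closed)
  moreover have "K \<noteq> {}" using norm_scale[OF g False] by blast
  ultimately obtain w where w: "w \<in> K"
    and wmin: "\<And>z. z \<in> K \<Longrightarrow> - ip (($) w) (L (($) w)) \<le> - ip (($) z) (L (($) z))"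
    using continuous_attains_inf[of K "\<lambda>w. - ip (($) w) (L (($) w))"]
      continuous_on_subset[OF cont(3)] by blast
  define f where "f = ($) w"
  define \<mu> where "\<mu> = - ip f (L f)"
  have f: "ip (\<lambda>_. 1) f = 0" "ip f f = 1" using w by (auto simp: K_def f_def)
  \<comment> \<open>The quadratic form of the Rayleigh deficit: nonnegative on mean-zero functions
    and zero at \<open>f\<close>.\<close>
  define Q where "Q = (\<lambda>h. - ip h (L h) - \<mu> * ip h h)"
  have Q: "0 \<le> Q h" if h: "ip (\<lambda>_. 1) h = 0" for h
  proof (cases "h = (\<lambda>_. 0)")
    case True
    then show ?thesis by (simp add: Q_def ip_def)
  next
    case False
    then obtain c where c: "c \<noteq> 0" "(\<chi> x. c * h x) \<in> K" using norm_scale h by blast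
    have "c\<^sup>2 * ip h h = 1"
      using c(2) by (simp add: K_def nth_lambda ip_scale ip_scale_right power2_eq_square)
    moreover have "\<mu> \<le> c\<^sup>2 * - ip h (L h)"
      using wmin[OF c(2)]
      by (simp add: \<mu>_def f_def nth_lambda laplacian_scale ip_scale ip_scale_right power2_eq_square)
    ultimately have "0 \<le> c\<^sup>2 * Q h" by (simp add: Q_def algebra_simps)
    then show ?thesis using c(1) by (simp add: zero_le_mult_iff)
  qed
  define r where "r = (\<lambda>x. L f x + \<mu> * f x)"
  have r1: "ip (\<lambda>_. 1) r = 0"
    by (simp add: r_def ip_add_right ip_scale_right ip_const_laplacian f)
  have expand: "Q (\<lambda>x. f x + \<epsilon> * r x) = - 2 * \<epsilon> * ip r r + \<epsilon>\<^sup>2 * Q r" for \<epsilon>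
  proof -
    have "ip r r = ip r (L f) + \<mu> * ip r f"
      by (subst (2) r_def) (simp add: ip_add_right ip_scale_right)
    then have "ip r (L f) = ip r r - \<mu> * ip r f" by simp
    moreover have "ip f (L r) = ip r (L f)"
      by (rule trans[OF ip_laplacian_sym ip_commute])
    ultimately show ?thesis
      using f by (simp add: Q_def \<mu>_def laplacian_add laplacian_scale ip_add ip_add_right ip_scale
          ip_scale_right ip_commute[of f r] algebra_simps power2_eq_square)
  qed
  have "ip r r = 0"
  proof (rule ccontr)
    assume "ip r r \<noteq> 0"
    then have A: "ip r r > 0" using ip_self_nonneg[of r] by simp
    have B: "Q r \<ge> 0" using Q[OF r1] .
    \<comment> \<open>Small enough that the quadratic term of \<open>expand\<close> is at most half
      the linear one in size; the \<open>+ 1\<close> avoids division by zero.\<close>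
    define \<epsilon> where "\<epsilon> = ip r r / (Q r + 1)"
    have \<epsilon>: "\<epsilon> > 0" "\<epsilon> * Q r \<le> ip r r"
      using A B by (auto simp: \<epsilon>_def field_simps)
    have "0 \<le> Q (\<lambda>x. f x + \<epsilon> * r x)"
      using f r1 by (intro Q) (simp add: ip_add_right ip_scale_right)
    also have "\<dots> = \<epsilon> * (\<epsilon> * Q r - 2 * ip r r)"
      unfolding expand by (simp add: algebra_simps power2_eq_square)
    finally show False using \<epsilon> A by (simp add: zero_le_mult_iff)
  qed
  then have "r x = 0" for x by (simp add: ip_self_eq_0)
  then have "- L f x = \<mu> * f x" for x
    unfolding r_def by (simp add: add_eq_0_iff)
  moreover have "f \<noteq> (\<lambda>_. 0)" using f(2) ip_self_eq_0[of f] by auto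
  ultimately have "is_eigenvalue_negLap q \<mu>" by (auto simp: is_eigenvalue_negLap_def)
  moreover have "\<mu> \<noteq> 0"
  proof
    assume "\<mu> = 0"
    then have "ip f (L f) = 0" by (simp add: \<mu>_def)
    \<comment> \<open>\<open>undefined\<close> is an arbitrary base vertex. A constant of mean zero
      cannot have norm one.\<close>
    have const: "f = (\<lambda>x. f undefined * 1)"
      unfolding mult_1_right by (intro ext ip_laplacian_eq_0) fact
    have "ip f f = f undefined * ip (\<lambda>_. 1) f"
      by (subst (1) const) (rule ip_scale)
    with f show False by simp
  qed
  ultimately have "lam \<le> \<mu>" using lam by (auto simp: smallest_nonzero_eigenvalue_def)
  then have "lam * ip g g \<le> \<mu> * ip g g" using ip_self_nonneg by (rule mult_right_mono)
  then show ?thesis using Q[OF g] by (simp add: Q_def)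
qed

section \<open>Solvability and contraction of the resolvent\<close>

text \<open>In finite dimension injectivity suffices, and a kernel vector satisfies
  \<open>ip w w = \<tau> * ip w (L w)\<close>, which is nonpositive.\<close>

lemma resolvent_exists:
  assumes "0 \<le> \<tau>"
  shows "\<exists>v. \<forall>z. v z - \<tau> * L v z = g z"
proof -
  define T where "T = (\<lambda>w :: real ^ 'a. \<chi> z. w $ z - \<tau> * L (($) w) z)"
  have plus: "($) (v + w) = (\<lambda>z. v $ z + w $ z)"
    and scale: "($) (c *\<^sub>R w) = (\<lambda>z. c * w $ z)" for v w :: "real ^ 'a" and c
    by (simp_all add: fun_eq_iff)
  have lin: "linear T"
  proof (rule linearI)
    show "T (v + w) = T v + T w" for v w
      by (simp add: T_def vec_eq_iff plus laplacian_add algebra_simps)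
    show "T (c *\<^sub>R w) = c *\<^sub>R T w" for c w
      by (simp add: T_def vec_eq_iff scale laplacian_scale algebra_simps)
  qed
  moreover have "inj T"
  proof (rule linear_injective_0[THEN iffD2, OF lin], intro allI impI)
    fix w assume "T w = 0"
    then have "($) w = (\<lambda>z. \<tau> * L (($) w) z)"
      by (simp add: T_def vec_eq_iff fun_eq_iff)
    then have "ip (($) w) (($) w) = \<tau> * ip (($) w) (L (($) w))"
      by (metis ip_scale_right)
    also have "\<dots> \<le> 0"
      using assms ip_laplacian_nonpos by (rule mult_nonneg_nonpos)
    finally have "ip (($) w) (($) w) = 0" using ip_self_nonneg[of "($) w"] by simp
    then show "w = 0" by (simp add: ip_self_eq_0 vec_eq_iff fun_eq_iff)
  qed
  ultimately have "surj T" by (rule linear_inj_imp_surj)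
  then obtain w where "T w = (\<chi> z. g z)" by (metis surjD)
  then have "\<forall>z. w $ z - \<tau> * L (($) w) z = g z" by (simp add: T_def vec_eq_iff)
  then show ?thesis by blast
qed

text \<open>On mean-zero functions the operator \<open>1 - L / lam\<close> is at least 2, so its
  inverse is at most one half. Diagonalisation is avoided by combining
  \<open>2 * ip w w \<le> ip g w\<close> with the nonnegative square of
  \<open>g / 2 - w\<close>.\<close>

lemma resolvent_contraction:
  assumes lam: "smallest_nonzero_eigenvalue q lam" and g: "ip (\<lambda>_. 1) g = 0"
    and w: "\<And>z. w z - (1 / lam) * L w z = g z"
  shows "ip g w \<le> ip g g / 2"
proof -
  have pos: "lam > 0"
    using lam eigenvalue_pos by (auto simp: smallest_nonzero_eigenvalue_def)
  have g_eq: "g = (\<lambda>z. w z + (- (1 / lam)) * L w z)" using w by (auto simp: fun_eq_iff)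
  have "ip (\<lambda>_. 1) w = 0"
    using g unfolding g_eq ip_add_right ip_scale_right ip_const_laplacian by simp
  then have "lam * ip w w \<le> - ip w (L w)" by (rule poincare[OF lam])
  then have "ip w w \<le> - (1 / lam) * ip w (L w)" using pos by (simp add: field_simps)
  moreover have "ip g w = ip w w + (- (1 / lam)) * ip w (L w)"
    unfolding g_eq by (simp only: ip_add ip_scale ip_commute[of "L w"])
  ultimately have "2 * ip w w \<le> ip g w" by simp
  moreover have "0 \<le> ip (\<lambda>x. (1 / 2) * g x + (- 1) * w x) (\<lambda>x. (1 / 2) * g x + (- 1) * w x)"
    by (rule ip_self_nonneg)
  then have "ip g w \<le> ip g g / 4 + ip w w"
    by (simp only: ip_add ip_scale ip_add_right ip_scale_right ip_commute[of w g]) (simp add: field_simps)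
  ultimately show ?thesis by simp
qed

section \<open>Flux through the boundary and isoperimetry\<close>

text \<open>By detailed balance the flux is antisymmetric, so edges inside \<open>A\<close> cancel
  and only boundary edges contribute.\<close>

lemma laplacian_flux_le_boundary:
  assumes v: "\<And>x y. q x y > 0 \<Longrightarrow> v x - v y \<le> p"
  shows "- (\<Sum>x\<in>A. m x * L v x) \<le> p * boundary q m A"
proof -
  let ?F = "\<lambda>x y. m x * q x y * (v x - v y)"
  let ?I = "\<Sum>x\<in>A. \<Sum>y\<in>A. ?F x y"
  have "?I = (\<Sum>y\<in>A. \<Sum>x\<in>A. ?F x y)" by (rule sum.swap)
  also have "\<dots> = (\<Sum>x\<in>A. \<Sum>y\<in>A. - ?F x y)"
    by (intro sum.cong refl) (simp add: detailed_balance algebra_simps)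
  also have "\<dots> = - ?I" by (simp add: sum_negf)
  finally have inner: "?I = 0" by simp
  have "- (\<Sum>x\<in>A. m x * L v x) = (\<Sum>x\<in>A. \<Sum>y\<in>UNIV. ?F x y)"
    by (simp add: laplacian_def sum_distrib_left flip: sum_negf) (simp add: algebra_simps)
  also have "\<dots> = (\<Sum>x\<in>A. (\<Sum>y\<in>UNIV - A. ?F x y) + (\<Sum>y\<in>A. ?F x y))"
    by (intro sum.cong refl sum.subset_diff) auto
  also have "\<dots> = (\<Sum>x\<in>A. \<Sum>y\<in>UNIV - A. ?F x y)"
    using inner by (simp add: sum.distrib)
  also have "\<dots> \<le> (\<Sum>x\<in>A. \<Sum>y\<in>UNIV - A. p * (m x * q x y))"
  proof (intro sum_mono)
    fix x y
    show "?F x y \<le> p * (m x * q x y)"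
    proof (cases "q x y > 0")
      case True
      then have "(m x * q x y) * (v x - v y) \<le> (m x * q x y) * p"
        using m_pos[of x] v by (intro mult_left_mono) auto
      then show ?thesis by (simp add: mult_ac)
    next
      case False
      then have "q x y = 0" using q_nonneg[of x y] by simp
      then show ?thesis by simp
    qed
  qed
  also have "\<dots> = p * boundary q m A" by (simp add: boundary_def sum_distrib_left)
  finally show ?thesis .
qed

text \<open>The spectral and flux estimates give \<open>lam / 4 \<le> p * H\<close> with
  \<open>H\<close> the boundary ratio; squaring and inserting
  \<open>p\<^sup>2 \<le> lam / (2 * q_min q)\<close> yields the claim.\<close>

lemma isoperimetric_bound:
  assumes curv: "nonneg_ollivier q" and lam: "smallest_nonzero_eigenvalue q lam"
    and "q_min q > 0" and "A \<noteq> {}" and A: "2 * meas m A \<le> meas m UNIV"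
  shows "sqrt (lam * q_min q / 8) \<le> boundary q m A / meas m A"
proof -
  have pos: "lam > 0"
    using lam eigenvalue_pos by (auto simp: smallest_nonzero_eigenvalue_def)
  define c where "c = 2 * q_min q * (1 / lam)"
  have "c > 0" using \<open>q_min q > 0\<close> pos by (simp add: c_def)
  have "\<exists>p\<ge>0. p \<le> 1 \<and> c * p\<^sup>2 + p = 1"
    by (rule IVT'[of "\<lambda>p. c * p\<^sup>2 + p"]) (use \<open>c > 0\<close> in \<open>auto intro!: continuous_intros\<close>)
  then obtain p where p: "0 \<le> p" "p \<le> 1" "c * p\<^sup>2 + p = 1" by blast
  have "p \<noteq> 0" "p \<noteq> 1" using p \<open>c > 0\<close> by auto
  then have p01: "0 < p" "p < 1" using p by auto
  define f where "f = (\<lambda>x. of_bool (x \<in> A) :: real)"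
  obtain v where v: "\<And>z. v z - (1 / lam) * L v z = f z"
    using resolvent_exists[of "1 / lam" f] pos by auto
  have "v b - v a \<le> 1 - (1 - p) ^ d a b" for a b
  proof (rule resolvent_modulus[OF curv _ p01 _ v])
    show "2 * q_min q * (1 / lam) * p\<^sup>2 + p = 1" using p(3) by (simp add: c_def)
  qed (use pos in \<open>simp_all add: f_def\<close>)
  \<comment> \<open>Adjacent vertices are at distance at most 1, where the modulus equals
    \<open>p\<close>.\<close>
  moreover have "1 - (1 - p) ^ d a b \<le> p" if "q a b > 0" for a b
    using gdist_edge[OF that] p01 by (cases "d a b") auto
  ultimately have edge: "v a - v b \<le> p" if "q a b > 0" for a b
    using that gdist_sym[of a b] by (metis order_trans)
  have flux: "- ip f (L v) \<le> p * boundary q m A"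
    using laplacian_flux_le_boundary[OF edge, where A = A]
    by (simp add: ip_def f_def of_bool_def if_distrib if_distribR sum.If_cases cong: if_cong)

  define M where "M = meas m A"
  define V where "V = meas m UNIV"
  define \<alpha> where "\<alpha> = M / V"
  have "M > 0" "V > 0"
    unfolding M_def V_def meas_def using m_pos \<open>A \<noteq> {}\<close> by (auto intro!: sum_pos)
  then have \<alpha>: "\<alpha> \<le> 1 / 2" "\<alpha> * V = M" using A by (auto simp: \<alpha>_def M_def V_def field_simps)
  \<comment> \<open>\<open>g\<close> is the projection of the indicator off the constants. Constants
    are fixed by the resolvent, so \<open>w\<close> solves the equation for \<open>g\<close>. The
    factor \<open>1\<close> lets the \<open>ip\<close> linearity rules apply.\<close>
  define g where "g = (\<lambda>z. f z + (- \<alpha>) * 1)"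
  define w where "w = (\<lambda>z. v z + (- \<alpha>))"
  have ips: "ip (\<lambda>_. 1) (\<lambda>_. 1) = V" "ip (\<lambda>_. 1) f = M" "ip f f = M"
    by (simp_all add: ip_def V_def M_def meas_def f_def of_bool_def if_distrib if_distribR
        sum.If_cases cong: if_cong)
  have g1: "ip (\<lambda>_. 1) g = 0"
    unfolding g_def ip_add_right ip_scale_right ips using \<alpha> by simp
  have "ip g g = M - \<alpha> * M"
    unfolding g_def ip_add_right ip_scale_right ip_add ip_scale ip_commute[of f "\<lambda>_. 1"] ips
    using \<alpha> by (simp add: algebra_simps)
  \<comment> \<open>The volume constraint on \<open>A\<close> enters here, through
    \<open>\<alpha> \<le> 1 / 2\<close>.\<close>
  also have "\<dots> \<ge> M / 2" using mult_right_mono[OF \<alpha>(1), of M] \<open>M > 0\<close> by simp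
  finally have gg: "M / 2 \<le> ip g g" .
  have Lw: "L w = L v" unfolding w_def laplacian_add laplacian_const by simp
  have w: "w z - (1 / lam) * L w z = g z" for z
    using v[of z] unfolding Lw by (simp add: w_def g_def)
  have "w = (\<lambda>z. g z + (1 / lam) * L v z)" using w Lw by (simp add: fun_eq_iff) (metis diff_add_cancel)
  moreover have "ip g (L v) = ip f (L v)"
    unfolding g_def ip_add ip_scale ip_const_laplacian by simp
  ultimately have "ip g w = ip g g + (1 / lam) * ip f (L v)"
    by (simp only: ip_add_right ip_scale_right)
  then have "ip g g / 2 \<le> - ((1 / lam) * ip f (L v))"
    using resolvent_contraction[OF lam g1 w] by linarith
  also have "\<dots> = (1 / lam) * - ip f (L v)" by simp
  also have "\<dots> \<le> (1 / lam) * (p * boundary q m A)"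
    using flux pos by (intro mult_left_mono) auto
  finally have "lam * ip g g \<le> 2 * (p * boundary q m A)"
    using pos by (simp add: field_simps)
  moreover have "lam * (M / 2) \<le> lam * ip g g"
    using gg pos by (intro mult_left_mono) auto
  ultimately have "lam / 4 \<le> p * (boundary q m A / M)"
    using \<open>M > 0\<close> by (simp add: field_simps)

  define H where "H = boundary q m A / M"
  have "0 \<le> H"
    unfolding H_def boundary_def using \<open>M > 0\<close> m_pos q_nonneg
    by (intro divide_nonneg_pos sum_nonneg) (simp_all add: less_imp_le)
  have "(lam / 4)\<^sup>2 \<le> (p * H)\<^sup>2"
    using \<open>lam / 4 \<le> p * (boundary q m A / M)\<close> pos unfolding H_def by (intro power_mono) auto
  also have "\<dots> = p\<^sup>2 * H\<^sup>2" by (simp add: power_mult_distrib)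
  also have "\<dots> \<le> (1 / c) * H\<^sup>2"
    using p \<open>c > 0\<close> by (intro mult_right_mono) (auto simp: field_simps)
  finally have "lam * q_min q / 8 \<le> H\<^sup>2"
    using pos \<open>q_min q > 0\<close> by (simp add: c_def field_simps power2_eq_square)
  then show ?thesis
    using \<open>0 \<le> H\<close> unfolding H_def M_def by (rule real_le_lsqrt[rotated])
qed

end

section \<open>Passage to the Cheeger constant\<close>

theorem mainTheorem13:
  fixes q :: "'a::finite \<Rightarrow> 'a \<Rightarrow> real" and m :: "'a \<Rightarrow> real" and lam :: real
  assumes "\<forall>x y. q x y \<ge> 0"
    and "reversible q m"
    and "connected_graph q"
    and "nonneg_ollivier q"
    and "smallest_nonzero_eigenvalue q lam"
  shows "lam \<le> 16 * ln 2 / q_min q * (cheeger q m)\<^sup>2"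
proof -
  interpret reversible_graph q m
    using assms by unfold_locales auto
  have lam: "is_eigenvalue_negLap q lam" "lam \<noteq> 0"
    using assms by (auto simp: smallest_nonzero_eigenvalue_def)
  \<comment> \<open>On a single vertex the Laplacian vanishes, leaving no non-zero
    eigenvalue.\<close>
  have "\<exists>x y :: 'a. x \<noteq> y"
  proof (rule ccontr)
    assume "\<nexists>x y :: 'a. x \<noteq> y"
    then have "laplacian q f x = 0" for f x
      unfolding laplacian_def by (intro sum.neutral) (metis diff_self mult_zero_right)
    then show False using lam by (auto simp: is_eigenvalue_negLap_def fun_eq_iff)
  qed
  then obtain x y :: 'a where "x \<noteq> y" by blast
  have qmin: "q_min q > 0" using q_min_pos[OF \<open>x \<noteq> y\<close>] .
  \<comment> \<open>The lighter of two vertices has at most half the mass, so the Cheeger infimum is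
    over a nonempty set.\<close>
  have "meas m {x, y} \<le> meas m UNIV"
    unfolding meas_def using m_pos by (intro sum_mono2) (auto simp: less_imp_le)
  then have "2 * meas m {x} \<le> meas m UNIV \<or> 2 * meas m {y} \<le> meas m UNIV"
    using \<open>x \<noteq> y\<close> by (auto simp: meas_def)
  then have ne: "{boundary q m A / meas m A | A. A \<noteq> {} \<and> 2 * meas m A \<le> meas m UNIV} \<noteq> {}"
    by blast
  have "sqrt (lam * q_min q / 8) \<le> cheeger q m"
    unfolding cheeger_def
    using isoperimetric_bound[OF assms(4,5) qmin] by (intro cInf_greatest[OF ne]) blast
  then have "lam * q_min q / 8 \<le> (cheeger q m)\<^sup>2"
    using eigenvalue_pos[OF lam] qmin sqrt_le_D by blast
  then have "lam \<le> 8 / q_min q * (cheeger q m)\<^sup>2"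
    using qmin by (simp add: field_simps)
  \<comment> \<open>\<open>ln (1 / 2) \<le> - 1 / 2\<close> gives
    \<open>8 \<le> 16 * ln 2\<close>.\<close>
  also have "\<dots> \<le> 16 * ln 2 / q_min q * (cheeger q m)\<^sup>2"
    using qmin ln_le_minus_one[of "1 / 2"] by (intro mult_right_mono divide_right_mono) (auto simp: ln_div)
  finally show ?thesis .
qed

end
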